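(* Let $n,p\ge 1$ and $1\le s\le p$ be integers, let $\Theta\subseteq\mathbb{R}^p$ be a given set, and suppose that $y=X\theta^*+\xi$ and $Z=X+\Xi$, where $\theta^*\in\Theta$ is $s$-sparse. Let $\varepsilon\ge 0$, let $b(\varepsilon)\ge0$ and $\delta_i(\varepsilon)\ge 0$, $i=1,\dots,5$, be thresholds satisfying $$\mathbb{P}\Big(\max_{1\le j\le p}|\hat\sigma_j^2-\sigma_j^2|\ge b(\varepsilon)\Big)\le\varepsilon,\qquad \mathbb{P}\big(|M^{(i)}|_\infty\ge\delta_i(\varepsilon)\big)\le\varepsilon,\quad i=1,\dots,5,$$ and put $\mu(\varepsilon)=\delta_1(\varepsilon)+\delta_4(\varepsilon)+\delta_5(\varepsilon)+b(\varepsilon)$, $\tau(\varepsilon)=\delta_2(\varepsilon)+\delta_3(\varepsilon)$, $$\mathcal{A}(\varepsilon)=\Big\{\theta\in\Theta:\ \Big|\tfrac1n Z^T(y-Z\theta)+\widehat D\theta\Big|_\infty\le\mu(\varepsilon)|\theta|_1+\tau(\varepsilon)\Big\},$$ $$\nu(\varepsilon)=2\big(\mu(\varepsilon)+\delta_1(\varepsilon)\big)|\theta^*|_1+2\tau(\varepsilon).$$ Then, with probability at least $1-6\varepsilon$, every solution $\hat\theta$ of the minimization problem $\min\{|\theta|_1:\ \theta\in\mathcal{A}(\varepsilon)\}$ satisfies the following inequalities. (i) Under Assumption RE($s$): $$|\hat\theta-\theta^*|_1\le\frac{4\nu(\varepsilon)s}{\kappa_{\rm RE}(s)},\qquad \frac1n|X(\hat\theta-\theta^*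 )|_2^2\le\frac{4\nu^2(\varepsilon)s}{\kappa_{\rm RE}(s)}.$$ (ii) Under Assumption RE($2s$), with $s\le p/2$: $$|\hat\theta-\theta^*|_q\le\frac{4\nu(\varepsilon)s^{1/q}}{\kappa_{\rm RE}(2s)}\quad\text{for all }1<q\le2.$$ (iii) Under Assumption C with $\rho<\frac1{2s}$: $$|\hat\theta-\theta^*|_q<\frac{(2s)^{1/q}\nu(\varepsilon)}{1-2\rho s}\quad\text{for all }1\le q\le\infty,$$ where $1/\infty=0$.
   Context: Model: $y\in\mathbb{R}^n$ and the $n\times p$ matrix $Z$ are observed; $X$ is an unknown $n\times p$ matrix (deterministic or random; if random, the assumptions below on $\Psi$ are required of its realizations), $\Xi$ is an $n\times p$ random noise matrix, $\xi\in\mathbb{R}^n$ is a random noise vector, $\theta^*$ is an unknown deterministic parameter vector. A vector is $s$-sparse if it has only $s$ non-zero components (i.e. at most $s$). Norms: $|\cdot|_q$ is the $\ell_q$-norm of a vector, $1\le q\le\infty$; for a matrix $A$, $|A|_\infty$ is the maximum absolute value of its entries. Variances: $\sigma_j^2=\frac1n\sum_{i=1}^n\mathbb{E}(\Xi_{ij}^2)$, assumed finite, $1\le j\le p$. $D$ is the $p\times p$ diagonal matrix with diagonal entries $\sigma_j^2$. The $\hat\sigma_j^2$ are given estimators (random variables) of $\sigma_j^2$, and $\widehat D$ is the diagonal matrix with diagonal entries $\hat\sigma_j^2$. Stochastic error terms: $M^{(1)}=\frac1nX^T\Xi$, $M^{(2)}=\frac1nX^T\xi$, $M^{(3)}=\frac1n\Xi^T\xi$,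 $M^{(4)}=\frac1n(\Xi^T\Xi-\mathrm{Diag}\{\Xi^T\Xi\})$, $M^{(5)}=\frac1n\mathrm{Diag}\{\Xi^T\Xi\}-D$, where $\mathrm{Diag}\{A\}$ is the diagonal matrix with the same diagonal as the square matrix $A$. Gram matrix and cones: $\Psi=\frac1nX^TX$. For $J\subseteq\{1,\dots,p\}$, $\Delta_J$ is the vector in $\mathbb{R}^p$ that agrees with $\Delta$ on $J$ and is zero on the complement $J^c$, and $C_J=\{\Delta\in\mathbb{R}^p:\ |\Delta_{J^c}|_1\le|\Delta_J|_1\}$. Assumption RE($s$) ($1\le s\le p$): there exists a constant $\kappa_{\rm RE}(s)>0$ such that $$\min_{\Delta\in C_J\setminus\{0\}}\frac{|\Delta^T\Psi\Delta|}{|\Delta_J|_2^2}\ge\kappa_{\rm RE}(s)$$ for all subsets $J$ of $\{1,\dots,p\}$ of cardinality $|J|\le s$. Assumption RE($2s$) is the same with $2s$ in place of $s$ and constant $\kappa_{\rm RE}(2s)$. Assumption C: all diagonal elements of $\Psi$ are equal to $1$ and its off-diagonal elements satisfy $\max_{i\ne j}|\Psi_{ij}|\le\rho$ for some $\rho<1$ (with $\rho\ge0$). *)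

theory Defs
  imports "HOL-Probability.Probability"
begin

text \<open>Meant for \<open>1 \<le> q \<le> \<infinity>\<close>; for finite \<open>q > 0\<close>, zero components contribute \<open>0 powr q = 0\<close>.\<close>

definition lq_norm :: "ereal \<Rightarrow> real ^ 'p \<Rightarrow> real" where
  "lq_norm q x =
     (if q = \<infinity> then (MAX j\<in>UNIV. \<bar>x $ j\<bar>)
      else (\<Sum>j\<in>UNIV. \<bar>x $ j\<bar> powr real_of_ereal q) powr (1 / real_of_ereal q))"

definition max_entry :: "real ^ 'p ^ 'n \<Rightarrow> real" where
  "max_entry A = (MAX (i, j)\<in>UNIV. \<bar>A $ i $ j\<bar>)"

definition s_sparse :: "nat \<Rightarrow> real ^ 'p \<Rightarrow> bool" where
  "s_sparse s x \<longleftrightarrow> card {j. x $ j \<noteq> 0} \<le> s"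

definition diag_mat :: "real ^ 'p \<Rightarrow> real ^ 'p ^ 'p" where
  "diag_mat v = (\<chi> i j. if i = j then v $ i else 0)"

definition Diag :: "real ^ 'p ^ 'p \<Rightarrow> real ^ 'p ^ 'p" where
  "Diag A = diag_mat (\<chi> i. A $ i $ i)"

definition noise_var :: "'w measure \<Rightarrow> ('w \<Rightarrow> real ^ 'p ^ 'n) \<Rightarrow> real ^ 'p" where
  "noise_var M \<Xi> =
     (\<chi> j. (\<Sum>i\<in>UNIV. (LINT \<omega>|M. (\<Xi> \<omega> $ i $ j)\<^sup>2)) / real CARD('n))"

text \<open>The stochastic error terms. The arguments \<open>X\<close>, \<open>\<Xi>\<close>, \<open>\<xi>\<close> are realizations;
  \<open>\<sigma>2\<close> is the vector of variances, so that \<open>D = diag_mat \<sigma>2\<close>.\<close>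

definition M1 :: "real ^ 'p ^ 'n \<Rightarrow> real ^ 'p ^ 'n \<Rightarrow> real ^ 'p ^ 'p" where
  "M1 X \<Xi> = (1 / real CARD('n)) *\<^sub>R (transpose X ** \<Xi>)"

definition M2 :: "real ^ 'p ^ 'n \<Rightarrow> real ^ 'n \<Rightarrow> real ^ 'p" where
  "M2 X \<xi> = (1 / real CARD('n)) *\<^sub>R (transpose X *v \<xi>)"

definition M3 :: "real ^ 'p ^ 'n \<Rightarrow> real ^ 'n \<Rightarrow> real ^ 'p" where
  "M3 \<Xi> \<xi> = (1 / real CARD('n)) *\<^sub>R (transpose \<Xi> *v \<xi>)"

definition M4 :: "real ^ 'p ^ 'n \<Rightarrow> real ^ 'p ^ 'p" where
  "M4 \<Xi> = (1 / real CARD('n)) *\<^sub>R (transpose \<Xi> ** \<Xi> - Diag (transpose \<Xi> ** \<Xi>))"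

definition M5 :: "real ^ 'p \<Rightarrow> real ^ 'p ^ 'n \<Rightarrow> real ^ 'p ^ 'p" where
  "M5 \<sigma>2 \<Xi> = (1 / real CARD('n)) *\<^sub>R Diag (transpose \<Xi> ** \<Xi>) - diag_mat \<sigma>2"

definition gram :: "real ^ 'p ^ 'n \<Rightarrow> real ^ 'p ^ 'p" where
  "gram X = (1 / real CARD('n)) *\<^sub>R (transpose X ** X)"

definition restr :: "'p set \<Rightarrow> real ^ 'p \<Rightarrow> real ^ 'p" where
  "restr J \<Delta> = (\<chi> j. if j \<in> J then \<Delta> $ j else 0)"

definition cone_C :: "'p set \<Rightarrow> (real ^ 'p) set" where
  "cone_C J = {\<Delta>. lq_norm 1 (restr (- J) \<Delta>) \<le> lq_norm 1 (restr J \<Delta>)}"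

text \<open>Assumption RE(\<open>s\<close>) with constant \<open>\<kappa>\<close>. On \<open>cone_C J - {0}\<close> the denominator is nonzero,
  and the bound on the minimum is stated as a bound on each ratio; for \<open>J = {}\<close> the cone is
  \<open>{0}\<close> and the condition is vacuous. \<open>norm\<close> is the Euclidean norm.\<close>

definition RE :: "real ^ 'p ^ 'p \<Rightarrow> nat \<Rightarrow> real \<Rightarrow> bool" where
  "RE \<Psi> s \<kappa> \<longleftrightarrow> \<kappa> > 0 \<and>
     (\<forall>J. card J \<le> s \<longrightarrow>
        (\<forall>\<Delta> \<in> cone_C J - {0}. \<bar>\<Delta> \<bullet> (\<Psi> *v \<Delta>)\<bar> / (norm (restr J \<Delta>))\<^sup>2 \<ge> \<kappa>))"

definition assumption_C :: "real ^ 'p ^ 'p \<Rightarrow> real \<Rightarrow> bool" where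
  "assumption_C \<Psi> \<rho> \<longleftrightarrow> 0 \<le> \<rho> \<and> \<rho> < 1 \<and>
     (\<forall>i. \<Psi> $ i $ i = 1) \<and> (\<forall>i j. i \<noteq> j \<longrightarrow> \<bar>\<Psi> $ i $ j\<bar> \<le> \<rho>)"

text \<open>The set \<open>\<A>(\<epsilon>)\<close> for one realization of the data \<open>Z\<close>, \<open>y\<close> and of the variance estimates
  \<open>\<sigma>2h\<close>.\<close>

definition feasible ::
  "(real ^ 'p) set \<Rightarrow> real ^ 'p ^ 'n \<Rightarrow> real ^ 'n \<Rightarrow> real ^ 'p \<Rightarrow> real \<Rightarrow> real \<Rightarrow> (real ^ 'p) set" where
  "feasible \<Theta> Z y \<sigma>2h \<mu> \<tau> =
     {\<theta> \<in> \<Theta>. lq_norm \<infinity> ((1 / real CARD('n)) *\<^sub>R (transpose Z *v (y - Z *v \<theta>))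
                + diag_mat \<sigma>2h *v \<theta>) \<le> \<mu> * lq_norm 1 \<theta> + \<tau>}"

end

theory Submission
  imports Defs
begin

text \<open>On the complement of the six bad events the residual at \<open>\<theta>\<^sup>*\<close> is pure noise, so \<open>\<theta>\<^sup>*\<close> is
  feasible; minimality then puts \<open>\<Delta> = \<theta>h - \<theta>\<^sup>*\<close> in the cone of the support of \<open>\<theta>\<^sup>*\<close>, and comparing
  the residual at \<open>\<theta>h\<close> with its noise part gives \<open>\<bar>\<Psi> \<Delta>\<bar>\<^sub>\<infinity> < \<nu>\<close>. From here the argument is
  deterministic: \<open>\<bar>\<Delta>\<^sup>T \<Psi> \<Delta>\<bar> \<le> \<nu> \<bar>\<Delta>\<bar>\<^sub>1\<close> is played against RE, and under Assumption C the \<open>j\<close>-th row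
  of \<open>\<Psi> \<Delta>\<close> is a perturbation of \<open>\<Delta>\<^sub>j\<close> by at most \<open>\<rho> \<bar>\<Delta>\<bar>\<^sub>1 \<le> 2 \<rho> s \<bar>\<Delta>\<bar>\<^sub>\<infinity>\<close>.\<close>

section \<open>Coordinate forms of the norms\<close>

lemma lq_norm_1: "lq_norm 1 x = (\<Sum>j\<in>UNIV. \<bar>x $ j\<bar>)"
  by (simp add: lq_norm_def sum_nonneg)

lemma lq_norm_infty_le_iff: "lq_norm \<infinity> x \<le> c \<longleftrightarrow> (\<forall>j. \<bar>x $ j\<bar> \<le> c)"
  by (simp add: lq_norm_def)

lemma lq_norm_infty_less_iff: "lq_norm \<infinity> x < c \<longleftrightarrow> (\<forall>j. \<bar>x $ j\<bar> < c)"
  by (simp add: lq_norm_def)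

lemma max_entry_less_iff: "max_entry A < c \<longleftrightarrow> (\<forall>i j. \<bar>A $ i $ j\<bar> < c)"
  by (simp add: max_entry_def split_beta)

lemma lq_norm_1_restr: "lq_norm 1 (restr J x) = (\<Sum>j\<in>J. \<bar>x $ j\<bar>)"
  by (simp add: lq_norm_1 restr_def if_distrib sum.If_cases)

lemma norm_power2_restr: "(norm (restr J x))\<^sup>2 = (\<Sum>j\<in>J. (x $ j)\<^sup>2)"
  by (simp add: norm_vec_def L2_set_def restr_def sum_nonneg if_distrib[of abs] if_distrib[of "\<lambda>x. x\<^sup>2"] sum.If_cases)

lemma in_cone_C_iff: "x \<in> cone_C J \<longleftrightarrow> (\<Sum>j\<in>-J. \<bar>x $ j\<bar>) \<le> (\<Sum>j\<in>J. \<bar>x $ j\<bar>)"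
  by (simp add: cone_C_def lq_norm_1_restr)

section \<open>The cones of dominant coordinates\<close>

lemma sum_UNIV_split:
  fixes f :: "'a::finite \<Rightarrow> real"
  shows "sum f UNIV = sum f J + sum f (- J)"
  by (metis Compl_eq_Diff_UNIV finite sum.subset_diff subset_UNIV add.commute)

text \<open>Enlarging the index set only moves mass from the dominated side to the dominating one.
  This lets RE be applied on a larger set than the support that produced the cone.\<close>

lemma cone_C_mono:
  assumes "J \<subseteq> K" shows "cone_C J \<subseteq> cone_C K"
proof
  fix x assume "x \<in> cone_C J"
  moreover have "(\<Sum>j\<in>-K. \<bar>x $ j\<bar>) \<le> (\<Sum>j\<in>-J. \<bar>x $ j\<bar>)" "(\<Sum>j\<in>J. \<bar>x $ j\<bar>) \<le> (\<Sum>j\<in>K. \<bar>x $ j\<bar>)"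
    using assms by (auto intro!: sum_mono2)
  ultimately show "x \<in> cone_C K" by (simp add: in_cone_C_iff)
qed

lemma cone_C_lq_norm_1:
  "x \<in> cone_C J \<Longrightarrow> lq_norm 1 x \<le> 2 * (\<Sum>j\<in>J. \<bar>x $ j\<bar>)"
  using sum_UNIV_split[of "\<lambda>j. \<bar>x $ j\<bar>" J] by (simp add: in_cone_C_iff lq_norm_1)

text \<open>Off the support the difference is just \<open>\<theta>h\<close>. Since
  \<open>\<theta>h\<close> has no larger norm, its mass there is at most what it lost on the
  support, and the triangle inequality bounds that loss by the difference on the support.\<close>

lemma diff_in_cone_C_support:
  assumes "lq_norm 1 \<theta>h \<le> lq_norm 1 \<theta>"
  shows "\<theta>h - \<theta> \<in> cone_C {j. \<theta> $ j \<noteq> 0}" (is "_ \<in> cone_C ?J")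
proof -
  have "(\<Sum>j\<in>-?J. \<bar>(\<theta>h - \<theta>) $ j\<bar>) = (\<Sum>j\<in>-?J. \<bar>\<theta>h $ j\<bar>)"
    by (rule sum.cong) auto
  also have "\<dots> = lq_norm 1 \<theta>h - (\<Sum>j\<in>?J. \<bar>\<theta>h $ j\<bar>)"
    using sum_UNIV_split[of "\<lambda>j. \<bar>\<theta>h $ j\<bar>" ?J] by (simp add: lq_norm_1)
  also have "\<dots> \<le> (\<Sum>j\<in>?J. \<bar>\<theta> $ j\<bar>) - (\<Sum>j\<in>?J. \<bar>\<theta>h $ j\<bar>)"
  proof -
    have "(\<Sum>j\<in>-?J. \<bar>\<theta> $ j\<bar>) = 0" by simp
    then show ?thesis
      using assms sum_UNIV_split[of "\<lambda>j. \<bar>\<theta> $ j\<bar>" ?J] by (simp add: lq_norm_1)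
  qed
  also have "\<dots> \<le> (\<Sum>j\<in>?J. \<bar>(\<theta>h - \<theta>) $ j\<bar>)"
    unfolding sum_subtractf[symmetric] by (rule sum_mono) simp
  finally show ?thesis by (simp add: in_cone_C_iff)
qed

section \<open>Matrix-vector bounds and the residual\<close>

lemma abs_matrix_vector_mult_le:
  fixes A :: "real ^ 'p ^ 'n"
  assumes "\<And>j. \<bar>A $ i $ j\<bar> \<le> d"
  shows "\<bar>(A *v x) $ i\<bar> \<le> d * lq_norm 1 x"
proof -
  have "\<bar>(A *v x) $ i\<bar> \<le> (\<Sum>j\<in>UNIV. \<bar>A $ i $ j * x $ j\<bar>)"
    by (simp add: matrix_vector_mult_def)
  also have "\<dots> \<le> (\<Sum>j\<in>UNIV. d * \<bar>x $ j\<bar>)"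
    using assms by (intro sum_mono) (auto simp: abs_mult intro: mult_right_mono)
  finally show ?thesis by (simp add: lq_norm_1 sum_distrib_left)
qed

lemma inner_gram: "x \<bullet> (gram A *v x) = (1 / real CARD('n)) * (norm (A *v x))\<^sup>2"
  for A :: "real ^ 'p ^ 'n"
  by (simp add: gram_def scaleR_matrix_vector_assoc[symmetric] matrix_vector_mul_assoc[symmetric]
      power2_norm_eq_inner dot_lmul_matrix[symmetric] inner_commute)

lemma abs_inner_le:
  assumes "\<And>j. \<bar>v $ j\<bar> \<le> c"
  shows "\<bar>x \<bullet> v\<bar> \<le> c * lq_norm 1 x"
proof -
  have "\<bar>x \<bullet> v\<bar> \<le> (\<Sum>j\<in>UNIV. \<bar>x $ j * v $ j\<bar>)"
    by (simp add: inner_vec_def)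
  also have "\<dots> \<le> (\<Sum>j\<in>UNIV. c * \<bar>x $ j\<bar>)"
    using assms by (intro sum_mono) (auto simp: abs_mult mult.commute intro: mult_right_mono)
  finally show ?thesis by (simp add: lq_norm_1 sum_distrib_left)
qed

text \<open>Expand \<open>transpose (X + \<Xi>)\<close> applied to
  \<open>\<xi> - X *v (\<theta> - \<theta>s) - \<Xi> *v \<theta>\<close>. The product of
  \<open>\<Xi>\<close> with itself splits into \<open>M4\<close>, \<open>M5\<close> and the diagonal
  of variances, which combines with the estimated diagonal. Only the last two terms depend on
  \<open>\<theta> - \<theta>s\<close>.\<close>

lemma residual_decomposition:
  fixes X \<Xi> :: "real ^ 'p ^ 'n"
  shows "(1 / real CARD('n)) *\<^sub>R (transpose (X + \<Xi>) *v (X *v \<theta>s + \<xi> - (X + \<Xi>) *v \<theta>)) + diag_mat \<sigma>2h *v \<theta>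
    = M2 X \<xi> + M3 \<Xi> \<xi> - M1 X \<Xi> *v \<theta> - M4 \<Xi> *v \<theta> - M5 \<sigma>2 \<Xi> *v \<theta>
      + diag_mat (\<sigma>2h - \<sigma>2) *v \<theta> - gram X *v (\<theta> - \<theta>s) - transpose (M1 X \<Xi>) *v (\<theta> - \<theta>s)"
proof -
  have T: "transpose (X + \<Xi>) = transpose X + transpose \<Xi>"
    "transpose (M1 X \<Xi>) = (1 / real CARD('n)) *\<^sub>R (transpose \<Xi> ** X)"
    "diag_mat (\<sigma>2h - \<sigma>2) = diag_mat \<sigma>2h - diag_mat \<sigma>2"
    by (simp_all add: vec_eq_iff transpose_def M1_def matrix_matrix_mult_def mult.commute diag_mat_def)
  show ?thesis
    \<comment> \<open>\<open>T\<close> goes first: once \<open>M1_def\<close> is unfolded, the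
      equation for \<open>transpose (M1 X \<Xi>)\<close> no longer matches.\<close>
    unfolding T unfolding M1_def M2_def M3_def M4_def M5_def gram_def
    by (simp add: algebra_simps scaleR_matrix_vector_assoc[symmetric]
        matrix_vector_mul_assoc[symmetric] del: transpose_matrix_vector)
qed

section \<open>Consequences of restricted eigenvalues\<close>

lemma sum_abs_power2_le: "(\<Sum>j\<in>J. \<bar>f j\<bar>)\<^sup>2 \<le> real (card J) * (\<Sum>j\<in>J. (f j)\<^sup>2)" for f :: "'a \<Rightarrow> real"
  using sum_squared_le_sum_of_squares[of "\<lambda>j. \<bar>f j\<bar>" J] by (simp add: mult.commute)

text \<open>RE on \<open>K\<close> and the cone of \<open>J\<close> give \<kappa> S \<le> \<nu>
  |\<Delta>|_1 \<le> 2 \<nu> |\<Delta>_J|_1, which Cauchy-Schwarz bounds by 2 \<nu> sqrt(s S), where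
  S is the squared norm on \<open>K\<close>. Squaring avoids the root, and one factor S cancels.
  \<open>K = J\<close> serves the \<ell>_1 bound, a larger \<open>K\<close> the \<ell>_2
  bound.\<close>

lemma RE_restricted_l2:
  assumes RE: "RE \<Psi> m \<kappa>" and K: "J \<subseteq> K" "card K \<le> m" and J: "card J \<le> s"
    and cone: "\<Delta> \<in> cone_C J" and le: "\<And>j. \<bar>(\<Psi> *v \<Delta>) $ j\<bar> \<le> \<nu>" and "\<nu> \<ge> 0"
  shows "(\<Sum>j\<in>K. (\<Delta> $ j)\<^sup>2) \<le> 4 * \<nu>\<^sup>2 * real s / \<kappa>\<^sup>2" (is "?S \<le> _")
\<comment> \<open>A nonzero \<open>?S\<close> excludes \<open>\<Delta> = 0\<close>, makes the ratio
  in RE meaningful, and can be cancelled at the end.\<close>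
proof (cases "?S = 0")
  case True
  then show ?thesis by simp
next
  case False
  then have S: "?S > 0" by (simp add: sum_nonneg less_le)
  have \<kappa>: "\<kappa> > 0" using RE by (simp add: RE_def)
  have "\<Delta> \<noteq> 0" using False by auto
  then have "\<kappa> \<le> \<bar>\<Delta> \<bullet> (\<Psi> *v \<Delta>)\<bar> / ?S"
    using RE K cone cone_C_mono[OF K(1)] unfolding RE_def norm_power2_restr by blast
  then have "\<kappa> * ?S \<le> \<bar>\<Delta> \<bullet> (\<Psi> *v \<Delta>)\<bar>"
    using S by (simp add: field_simps)
  also have "\<dots> \<le> \<nu> * lq_norm 1 \<Delta>" using le by (rule abs_inner_le)
  also have "\<dots> \<le> \<nu> * (2 * (\<Sum>j\<in>J. \<bar>\<Delta> $ j\<bar>))"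
    using cone_C_lq_norm_1[OF cone] \<open>\<nu> \<ge> 0\<close> by (rule mult_left_mono)
  finally have "(\<kappa> * ?S)\<^sup>2 \<le> (\<nu> * (2 * (\<Sum>j\<in>J. \<bar>\<Delta> $ j\<bar>)))\<^sup>2"
    using \<kappa> S by (intro power_mono) auto
  also have "\<dots> = 4 * \<nu>\<^sup>2 * (\<Sum>j\<in>J. \<bar>\<Delta> $ j\<bar>)\<^sup>2" by (simp add: power_mult_distrib)
  also have "\<dots> \<le> 4 * \<nu>\<^sup>2 * (real s * ?S)"
  proof (rule mult_left_mono)
    have "(\<Sum>j\<in>J. \<bar>\<Delta> $ j\<bar>)\<^sup>2 \<le> real (card J) * (\<Sum>j\<in>J. (\<Delta> $ j)\<^sup>2)" by (rule sum_abs_power2_le)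
    also have "\<dots> \<le> real s * ?S"
      using J K by (intro mult_mono sum_mono2) (auto intro: sum_nonneg)
    finally show "(\<Sum>j\<in>J. \<bar>\<Delta> $ j\<bar>)\<^sup>2 \<le> real s * ?S" .
  qed simp
  finally have "\<kappa>\<^sup>2 * ?S * ?S \<le> 4 * \<nu>\<^sup>2 * real s * ?S"
    by (simp add: power2_eq_square mult_ac)
  then have "\<kappa>\<^sup>2 * ?S \<le> 4 * \<nu>\<^sup>2 * real s" using S by simp
  then show ?thesis using \<kappa> by (simp add: field_simps)
qed

text \<open>In the cone, |\<Delta>|_1 \<le> 2 |\<Delta>_J|_1 \<le> 2 sqrt(s) |\<Delta>_J|_2, and the
  last norm is bounded with \<open>K = J\<close>. The separate \<open>m\<close> lets the bound serve
  under both RE(s) and RE(2s).\<close>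

lemma RE_l1_bound:
  assumes RE: "RE \<Psi> m \<kappa>" "s \<le> m" and J: "card J \<le> s"
    and cone: "\<Delta> \<in> cone_C J" and le: "\<And>j. \<bar>(\<Psi> *v \<Delta>) $ j\<bar> \<le> \<nu>" and "\<nu> \<ge> 0"
  shows "lq_norm 1 \<Delta> \<le> 4 * \<nu> * real s / \<kappa>"
proof (rule power2_le_imp_le)
  have \<kappa>: "\<kappa> > 0" using RE by (simp add: RE_def)
  have "(lq_norm 1 \<Delta>)\<^sup>2 \<le> (2 * (\<Sum>j\<in>J. \<bar>\<Delta> $ j\<bar>))\<^sup>2"
    using cone_C_lq_norm_1[OF cone] by (intro power_mono) (auto simp: lq_norm_1 sum_nonneg)
  also have "\<dots> \<le> 4 * (real s * (\<Sum>j\<in>J. (\<Delta> $ j)\<^sup>2))"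
    using sum_abs_power2_le[of "\<lambda>j. \<Delta> $ j" J] J
      mult_right_mono[of "real (card J)" "real s" "\<Sum>j\<in>J. (\<Delta> $ j)\<^sup>2"]
    by (simp add: power_mult_distrib sum_nonneg)
  also have "\<dots> \<le> 4 * (real s * (4 * \<nu>\<^sup>2 * real s / \<kappa>\<^sup>2))"
    using RE_restricted_l2[OF RE(1) order_refl _ J cone le \<open>\<nu> \<ge> 0\<close>] J RE(2)
    by (intro mult_left_mono) auto
  also have "\<dots> = (4 * \<nu> * real s / \<kappa>)\<^sup>2"
    by (simp add: power2_eq_square)
  finally show "(lq_norm 1 \<Delta>)\<^sup>2 \<le> (4 * \<nu> * real s / \<kappa>)\<^sup>2" .
  show "0 \<le> 4 * \<nu> * real s / \<kappa>" using \<kappa> \<open>\<nu> \<ge> 0\<close> by simp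
qed

text \<open>Greedy choice: a maximizer of \<open>f\<close> on the remaining elements lies below all
  earlier choices and above everything left.\<close>

lemma exists_top_subset:
  fixes f :: "'a \<Rightarrow> 'b::linorder"
  assumes "finite A" "k \<le> card A"
  shows "\<exists>B\<subseteq>A. card B = k \<and> (\<forall>b\<in>B. \<forall>a\<in>A - B. f a \<le> f b)"
  using assms(2)
proof (induction k)
  case 0
  then show ?case by (intro exI[of _ "{}"]) simp
next
  case (Suc k)
  then obtain B where B: "B \<subseteq> A" "card B = k" "\<forall>b\<in>B. \<forall>a\<in>A - B. f a \<le> f b" by auto
  have fin: "finite B" "finite (A - B)" using B assms(1) finite_subset by auto
  have "A - B \<noteq> {}" using B Suc.prems by auto
  then have "Max (f ` (A - B)) \<in> f ` (A - B)" using fin by (intro Max_in) auto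
  then obtain m where m: "m \<in> A - B" "f m = Max (f ` (A - B))" by auto
  then have "f a \<le> f m" if "a \<in> A - B" for a using that fin by simp
  then show ?case using B m fin by (intro exI[of _ "insert m B"]) auto
qed

text \<open>An entry outside \<open>B\<close> is at most the average over \<open>B\<close>, hence at
  most the total divided by \<open>s\<close>. Multiplying by the entry itself and summing gives the
  claim.\<close>

lemma sum_power2_tail_le:
  fixes f :: "'a \<Rightarrow> real"
  assumes A: "finite A" "B \<subseteq> A" "card B = s" "s > 0"
    and f: "\<And>b a. b \<in> B \<Longrightarrow> a \<in> A - B \<Longrightarrow> \<bar>f a\<bar> \<le> \<bar>f b\<bar>"
  shows "real s * (\<Sum>a\<in>A - B. (f a)\<^sup>2) \<le> (\<Sum>a\<in>A. \<bar>f a\<bar>)\<^sup>2"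
proof -
  let ?T = "\<Sum>a\<in>A. \<bar>f a\<bar>"
  have "real s * (f a)\<^sup>2 \<le> ?T * \<bar>f a\<bar>" if a: "a \<in> A - B" for a
  proof -
    have "real s * \<bar>f a\<bar> = (\<Sum>b\<in>B. \<bar>f a\<bar>)" using A by simp
    also have "\<dots> \<le> (\<Sum>b\<in>B. \<bar>f b\<bar>)" using f a by (intro sum_mono)
    also have "\<dots> \<le> ?T" using A by (intro sum_mono2) auto
    finally have "real s * \<bar>f a\<bar> * \<bar>f a\<bar> \<le> ?T * \<bar>f a\<bar>" by (rule mult_right_mono) simp
    then show ?thesis by (simp add: power2_eq_square)
  qed
  then have "real s * (\<Sum>a\<in>A - B. (f a)\<^sup>2) \<le> ?T * (\<Sum>a\<in>A - B. \<bar>f a\<bar>)"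
    unfolding sum_distrib_left by (rule sum_mono)
  also have "\<dots> \<le> ?T * ?T"
    using A by (intro mult_left_mono sum_mono2) (auto intro: sum_nonneg)
  finally show ?thesis by (simp add: power2_eq_square)
qed

text \<open>The squared tail off \<open>K\<close> is at most |\<Delta>_{J^c}|_1^2 / s, which the
  cone and Cauchy-Schwarz bound by the squared norm on \<open>J\<close>. So the whole sum is at most
  twice the sum over \<open>K\<close>, whence 8 = 2 * 4.\<close>

lemma RE_l2_bound:
  assumes RE: "RE \<Psi> (2 * s) \<kappa>" and "s > 0" and J: "card J \<le> s"
    and cone: "\<Delta> \<in> cone_C J" and le: "\<And>j. \<bar>(\<Psi> *v \<Delta>) $ j\<bar> \<le> \<nu>" and "\<nu> \<ge> 0"
  shows "(\<Sum>j\<in>UNIV. (\<Delta> $ j)\<^sup>2) \<le> 8 * \<nu>\<^sup>2 * real s / \<kappa>\<^sup>2"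
proof -
  \<comment> \<open>\<open>K\<close> is \<open>J\<close> together with the \<open>s\<close> largest components of \<open>\<Delta>\<close> outside \<open>J\<close>.\<close>
  obtain K where K: "J \<subseteq> K" "card K \<le> 2 * s"
    and tail: "(\<Sum>j\<in>-K. (\<Delta> $ j)\<^sup>2) \<le> (\<Sum>j\<in>J. (\<Delta> $ j)\<^sup>2)"
  proof (cases "card (- J) \<le> s")
    case True
    \<comment> \<open>Too few indices outside \<open>J\<close> to need a selection: all of them fit
      into \<open>K\<close>, and the tail is empty.\<close>
    have "card (UNIV :: 'a set) \<le> card J + card (- J)"
      using card_Un_le[of J "- J"] by simp
    with True J show ?thesis by (intro that[of UNIV]) (auto intro: sum_nonneg)
  next
    case False
    obtain B where B: "B \<subseteq> - J" "card B = s" "\<forall>b\<in>B. \<forall>a\<in>- J - B. \<bar>\<Delta> $ a\<bar> \<le> \<bar>\<Delta> $ b\<bar>"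
      using False exists_top_subset[of "- J" s "\<lambda>j. \<bar>\<Delta> $ j\<bar>"] by auto
    have "real s * (\<Sum>a\<in>- J - B. (\<Delta> $ a)\<^sup>2) \<le> (\<Sum>a\<in>- J. \<bar>\<Delta> $ a\<bar>)\<^sup>2"
      using B \<open>s > 0\<close> by (intro sum_power2_tail_le) auto
    also have "\<dots> \<le> (\<Sum>a\<in>J. \<bar>\<Delta> $ a\<bar>)\<^sup>2"
      using cone by (intro power_mono) (auto simp: in_cone_C_iff intro: sum_nonneg)
    also have "\<dots> \<le> real (card J) * (\<Sum>j\<in>J. (\<Delta> $ j)\<^sup>2)" by (rule sum_abs_power2_le)
    also have "\<dots> \<le> real s * (\<Sum>j\<in>J. (\<Delta> $ j)\<^sup>2)"
      using J by (intro mult_right_mono) (auto intro: sum_nonneg)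
    finally have "(\<Sum>a\<in>- J - B. (\<Delta> $ a)\<^sup>2) \<le> (\<Sum>j\<in>J. (\<Delta> $ j)\<^sup>2)"
      using \<open>s > 0\<close> by simp
    moreover have "- J - B = - (J \<union> B)" by auto
    ultimately show ?thesis using card_Un_le[of J B] B J by (intro that[of "J \<union> B"]) auto
  qed
  have "(\<Sum>j\<in>J. (\<Delta> $ j)\<^sup>2) \<le> (\<Sum>j\<in>K. (\<Delta> $ j)\<^sup>2)" using K by (intro sum_mono2) auto
  then show ?thesis
    using tail RE_restricted_l2[OF RE K J cone le \<open>\<nu> \<ge> 0\<close>] sum_UNIV_split[of "\<lambda>j. (\<Delta> $ j)\<^sup>2" K]
    by simp
qed

section \<open>Interpolation between norms\<close>

text \<open>Summed over the rescaled components, this replaces Hoelder's inequality in passing from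
  \<open>\<ell>\<^sub>1\<close> and \<open>\<ell>\<^sub>2\<close> bounds to an \<open>\<ell>\<^sub>q\<close> bound.\<close>

lemma powr_interpolation:
  fixes u q :: real
  assumes "u \<ge> 0" "1 < q" "q \<le> 2"
  shows "u powr q \<le> (2 - q) * u + (q - 1) * u\<^sup>2"
proof (cases "u = 0")
  case False
  \<comment> \<open>Weighted arithmetic-geometric mean of \<open>u\<close> and 1 with weights
    \<open>q - 1\<close> and \<open>2 - q\<close>; multiplying by \<open>u\<close> then gives the
    claim.\<close>
  with assms have "u powr (q - 1) * 1 powr (2 - q) \<le> (q - 1) * u + (2 - q) * 1"
    by (intro Youngs_inequality_0) auto
  then have "u * u powr (q - 1) \<le> u * ((q - 1) * u + (2 - q))"
    using assms by (intro mult_left_mono) auto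
  then show ?thesis using False assms
    by (simp add: powr_mult_base algebra_simps power2_eq_square)
qed (use assms in auto)

text \<open>For the rescaled components u = |x_j| / t the hypotheses say that the sums of u and of
  u^2 are at most \<open>r\<close>. The weights \<open>2 - q\<close> and \<open>q - 1\<close> add up
  to 1, so the sum of u^q is at most \<open>r\<close> as well.\<close>

lemma lq_norm_le_interpolation:
  assumes q: "1 < q" "q \<le> 2" and t: "t > 0" "r > 0"
    and l1: "lq_norm 1 x \<le> t * r" and l2: "(\<Sum>j\<in>UNIV. (x $ j)\<^sup>2) \<le> t\<^sup>2 * r"
  shows "lq_norm (ereal q) x \<le> t * r powr (1 / q)"
proof -
  have "(\<Sum>j\<in>UNIV. \<bar>x $ j\<bar> powr q) = t powr q * (\<Sum>j\<in>UNIV. (\<bar>x $ j\<bar> / t) powr q)"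
    using t by (simp add: powr_divide sum_distrib_left)
  also have "\<dots> \<le> t powr q * (\<Sum>j\<in>UNIV. (2 - q) * (\<bar>x $ j\<bar> / t) + (q - 1) * (\<bar>x $ j\<bar> / t)\<^sup>2)"
    using t q by (intro mult_left_mono sum_mono powr_interpolation) auto
  also have "(\<Sum>j\<in>UNIV. (2 - q) * (\<bar>x $ j\<bar> / t) + (q - 1) * (\<bar>x $ j\<bar> / t)\<^sup>2)
      = (2 - q) * (lq_norm 1 x / t) + (q - 1) * ((\<Sum>j\<in>UNIV. (x $ j)\<^sup>2) / t\<^sup>2)"
    by (simp add: sum.distrib sum_distrib_left sum_divide_distrib lq_norm_1 power_divide)
  also have "\<dots> \<le> (2 - q) * r + (q - 1) * r"
    using q t l1 l2 by (intro add_mono mult_left_mono) (auto simp: field_simps)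
  finally have "(\<Sum>j\<in>UNIV. \<bar>x $ j\<bar> powr q) \<le> t powr q * r"
    by (simp add: left_diff_distrib mult_left_mono)
  then have "lq_norm (ereal q) x \<le> (t powr q * r) powr (1 / q)"
    using q by (auto simp: lq_norm_def intro!: powr_mono2 sum_nonneg)
  also have "\<dots> = t * r powr (1 / q)"
    using q t by (simp add: powr_mult powr_powr)
  finally show ?thesis .
qed

text \<open>For finite exponent p, |x_j|^p \<le> m^(p-1) |x_j|, and the \<ell>_1 bound turns the sum
  into r m^p.\<close>

lemma lq_norm_le_infty:
  assumes q: "1 \<le> q" and m: "\<And>j. \<bar>x $ j\<bar> \<le> m" and l1: "lq_norm 1 x \<le> r * m" and "r > 0"
  shows "lq_norm q x \<le> r powr real_of_ereal (1 / q) * m"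
proof (cases q)
  case PInf
  \<comment> \<open>Here \<open>1 / q\<close> is 0, and the factor \<open>r powr 0\<close> is 1
    because \<open>r\<close> is positive.\<close>
  then show ?thesis using m \<open>r > 0\<close> by (simp add: lq_norm_infty_le_iff)
next
  case (real p)
  then have p: "1 \<le> p" using q by simp
  have m0: "m \<ge> 0" using m[of undefined] by linarith
  have "\<bar>x $ j\<bar> powr p \<le> m powr (p - 1) * \<bar>x $ j\<bar>" for j
  proof (cases "x $ j = 0")
    case False
    have "\<bar>x $ j\<bar> powr p = \<bar>x $ j\<bar> powr (p - 1) * \<bar>x $ j\<bar>"
      by (simp add: powr_mult_base mult.commute)
    also have "\<dots> \<le> m powr (p - 1) * \<bar>x $ j\<bar>"
      using m p by (intro mult_right_mono powr_mono2) auto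
    finally show ?thesis .
  qed (use p in simp)
  then have "(\<Sum>j\<in>UNIV. \<bar>x $ j\<bar> powr p) \<le> m powr (p - 1) * lq_norm 1 x"
    unfolding lq_norm_1 sum_distrib_left by (rule sum_mono)
  also have "\<dots> \<le> m powr (p - 1) * (r * m)" using l1 by (rule mult_left_mono) simp
  also have "\<dots> = r * m powr p" using m0 by (simp add: powr_mult_base mult_ac)
  finally have "lq_norm q x \<le> (r * m powr p) powr (1 / p)"
    using p by (auto simp: real lq_norm_def intro!: powr_mono2 sum_nonneg)
  also have "\<dots> = r powr real_of_ereal (1 / q) * m"
    using p m0 \<open>r > 0\<close> by (simp add: real powr_mult powr_powr one_ereal_def)
  finally show ?thesis .
qed (use q in auto)

section \<open>Consequences of Assumption C\<close>

text \<open>\<open>\<Psi> - mat 1\<close> has zero diagonal, so all its entries are bounded by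
  \<open>\<rho>\<close>. The sup norm of \<open>\<Delta>\<close> then appears on both sides of an
  inequality that can be solved because 2 \<rho> s < 1. Strictness survives the maximum since there
  are finitely many coordinates.\<close>

lemma assumption_C_infty_bound:
  assumes C: "assumption_C \<Psi> \<rho>" "\<rho> < 1 / (2 * real s)" and "s > 0" and J: "card J \<le> s"
    and cone: "\<Delta> \<in> cone_C J" and less: "\<And>j. \<bar>(\<Psi> *v \<Delta>) $ j\<bar> < \<nu>"
  shows "lq_norm 1 \<Delta> \<le> 2 * real s * lq_norm \<infinity> \<Delta>"
    and "lq_norm \<infinity> \<Delta> < \<nu> / (1 - 2 * \<rho> * real s)"
proof -
  have le: "\<bar>\<Delta> $ j\<bar> \<le> lq_norm \<infinity> \<Delta>" for j
    using lq_norm_infty_le_iff[of \<Delta> "lq_norm \<infinity> \<Delta>"] by simp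
  have "(\<Sum>j\<in>J. \<bar>\<Delta> $ j\<bar>) \<le> real (card J) * lq_norm \<infinity> \<Delta>"
    using le by (intro sum_bounded_above)
  also have "\<dots> \<le> real s * lq_norm \<infinity> \<Delta>"
    using J le[of undefined] by (intro mult_right_mono) auto
  finally show l1: "lq_norm 1 \<Delta> \<le> 2 * real s * lq_norm \<infinity> \<Delta>"
    using cone_C_lq_norm_1[OF cone] by simp
  have \<rho>: "0 \<le> \<rho>" using C by (simp add: assumption_C_def)
  have "\<bar>\<Delta> $ j\<bar> < \<nu> + 2 * \<rho> * real s * lq_norm \<infinity> \<Delta>" for j
  proof -
    have "\<bar>((\<Psi> - mat 1) *v \<Delta>) $ j\<bar> \<le> \<rho> * lq_norm 1 \<Delta>"
      using C by (intro abs_matrix_vector_mult_le) (auto simp: assumption_C_def mat_def)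
    also have "\<dots> \<le> \<rho> * (2 * real s * lq_norm \<infinity> \<Delta>)"
      using l1 \<rho> by (rule mult_left_mono)
    finally show ?thesis
      using less[of j] by (simp add: matrix_vector_mult_diff_rdistrib)
  qed
  then have "lq_norm \<infinity> \<Delta> < \<nu> + 2 * \<rho> * real s * lq_norm \<infinity> \<Delta>"
    by (subst lq_norm_infty_less_iff) blast
  then have "lq_norm \<infinity> \<Delta> * (1 - 2 * \<rho> * real s) < \<nu>"
    by (simp add: algebra_simps)
  moreover have "1 - 2 * \<rho> * real s > 0" using C(2) \<open>s > 0\<close> by (simp add: field_simps)
  ultimately show "lq_norm \<infinity> \<Delta> < \<nu> / (1 - 2 * \<rho> * real s)"
    by (simp add: less_divide_eq)
qed

section \<open>Deterministic analysis outside the bad events\<close>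

text \<open>One realization for which all six bad events fail. As these events use \<ge>, the
  inequalities are strict, and they force the thresholds to be positive.\<close>

locale small_errors =
  fixes X \<Xi> :: "real ^ 'p ^ 'n" and \<xi> :: "real ^ 'n" and \<sigma>2h \<sigma>2 \<theta>s :: "real ^ 'p"
    and b \<delta>1 \<delta>2 \<delta>3 \<delta>4 \<delta>5 \<mu> \<tau> \<nu> :: real
  assumes var: "(MAX j\<in>UNIV. \<bar>\<sigma>2h $ j - \<sigma>2 $ j\<bar>) < b"
    and M1: "max_entry (M1 X \<Xi>) < \<delta>1"
    and M2: "lq_norm \<infinity> (M2 X \<xi>) < \<delta>2"
    and M3: "lq_norm \<infinity> (M3 \<Xi> \<xi>) < \<delta>3"
    and M4: "max_entry (M4 \<Xi>) < \<delta>4"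
    and M5: "max_entry (M5 \<sigma>2 \<Xi>) < \<delta>5"
    and \<mu>: "\<mu> = \<delta>1 + \<delta>4 + \<delta>5 + b"
    and \<tau>: "\<tau> = \<delta>2 + \<delta>3"
    and \<nu>: "\<nu> = 2 * (\<mu> + \<delta>1) * lq_norm 1 \<theta>s + 2 * \<tau>"
begin

text \<open>Each matrix term costs its threshold times the \<ell>_1 norm, and the two vectors cost
  \<open>\<tau>\<close>. The vectors supply the strictness, so it holds even at
  \<open>\<theta> = 0\<close>. The bound is needed at the true parameter and at the
  minimizer.\<close>

lemma noise_less:
  "\<bar>(M2 X \<xi> + M3 \<Xi> \<xi> - M1 X \<Xi> *v \<theta> - M4 \<Xi> *v \<theta> - M5 \<sigma>2 \<Xi> *v \<theta>
      + diag_mat (\<sigma>2h - \<sigma>2) *v \<theta>) $ j\<bar> < \<mu> * lq_norm 1 \<theta> + \<tau>"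
proof -
  have b: "\<bar>\<sigma>2h $ j - \<sigma>2 $ j\<bar> < b" for j using var by simp
  \<comment> \<open>Needed for the zero off-diagonal entries of \<open>diag_mat\<close>; any index,
    here \<open>undefined\<close>, yields it.\<close>
  have "b > 0" using b[of undefined] by linarith
  have "\<bar>(M1 X \<Xi> *v \<theta>) $ j\<bar> \<le> \<delta>1 * lq_norm 1 \<theta>"
    using M1 by (intro abs_matrix_vector_mult_le) (simp add: max_entry_less_iff less_imp_le)
  moreover have "\<bar>(M4 \<Xi> *v \<theta>) $ j\<bar> \<le> \<delta>4 * lq_norm 1 \<theta>"
    using M4 by (intro abs_matrix_vector_mult_le) (simp add: max_entry_less_iff less_imp_le)
  moreover have "\<bar>(M5 \<sigma>2 \<Xi> *v \<theta>) $ j\<bar> \<le> \<delta>5 * lq_norm 1 \<theta>"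
    using M5 by (intro abs_matrix_vector_mult_le) (simp add: max_entry_less_iff less_imp_le)
  moreover have "\<bar>(diag_mat (\<sigma>2h - \<sigma>2) *v \<theta>) $ j\<bar> \<le> b * lq_norm 1 \<theta>"
    using b \<open>b > 0\<close> by (intro abs_matrix_vector_mult_le) (simp add: diag_mat_def less_imp_le)
  moreover have "\<bar>M2 X \<xi> $ j\<bar> < \<delta>2" "\<bar>M3 \<Xi> \<xi> $ j\<bar> < \<delta>3"
    using M2 M3 by (simp_all add: lq_norm_infty_less_iff)
  ultimately show ?thesis by (simp add: \<mu> \<tau> distrib_right)
qed

lemma true_parameter_feasible:
  assumes "\<theta>s \<in> \<Theta>"
  shows "\<theta>s \<in> feasible \<Theta> (X + \<Xi>) (X *v \<theta>s + \<xi>) \<sigma>2h \<mu> \<tau>"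
  using assms noise_less[of \<theta>s, THEN less_imp_le]
  \<comment> \<open>The terms in \<open>\<theta> - \<theta>s\<close> vanish here.
    \<open>\<sigma>2\<close> does not occur in the residual, so the rewriting must be told its
    value.\<close>
  unfolding feasible_def residual_decomposition[of _ _ _ _ _ _ \<sigma>2] lq_norm_infty_le_iff by simp

lemma minimizer_lq_norm_1_le:
  assumes "\<theta>s \<in> \<Theta>"
    and "is_arg_min (lq_norm 1) (\<lambda>\<theta>. \<theta> \<in> feasible \<Theta> (X + \<Xi>) (X *v \<theta>s + \<xi>) \<sigma>2h \<mu> \<tau>) \<theta>h"
  shows "lq_norm 1 \<theta>h \<le> lq_norm 1 \<theta>s"
  using assms true_parameter_feasible by (auto simp: is_arg_min_def not_less)

text \<open>Solve the decomposition for the Gram term. The residual and the noise each contribute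
  \<mu> |\<theta>h|_1 + \<tau>, the cross term with \<open>transpose (M1 X \<Xi>)\<close>
  contributes 2 \<delta>1 |\<theta>s|_1, and minimality replaces |\<theta>h|_1 by |\<theta>s|_1; the
  total is \<open>\<nu>\<close>.\<close>

lemma gram_residual_less:
  assumes feas: "\<theta>h \<in> feasible \<Theta> (X + \<Xi>) (X *v \<theta>s + \<xi>) \<sigma>2h \<mu> \<tau>"
    and l1: "lq_norm 1 \<theta>h \<le> lq_norm 1 \<theta>s"
  shows "\<bar>(gram X *v (\<theta>h - \<theta>s)) $ j\<bar> < \<nu>"
proof -
  let ?r = "(1 / real CARD('n)) *\<^sub>R (transpose (X + \<Xi>) *v (X *v \<theta>s + \<xi> - (X + \<Xi>) *v \<theta>h))
    + diag_mat \<sigma>2h *v \<theta>h"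
  let ?w = "M2 X \<xi> + M3 \<Xi> \<xi> - M1 X \<Xi> *v \<theta>h - M4 \<Xi> *v \<theta>h - M5 \<sigma>2 \<Xi> *v \<theta>h
      + diag_mat (\<sigma>2h - \<sigma>2) *v \<theta>h"
  have "\<delta>1 > 0" "\<delta>4 > 0" "\<delta>5 > 0" "b > 0"
    using M1 M4 M5 var unfolding max_entry_less_iff
    by (simp_all, (meson abs_ge_zero le_less_trans)+)
  then have pos: "\<delta>1 > 0" "\<mu> > 0" by (simp_all add: \<mu>)
  have "\<bar>(transpose (M1 X \<Xi>) *v (\<theta>h - \<theta>s)) $ j\<bar> \<le> \<delta>1 * lq_norm 1 (\<theta>h - \<theta>s)"
    using M1 by (intro abs_matrix_vector_mult_le) (simp add: max_entry_less_iff less_imp_le transpose_def)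
  also have "\<dots> \<le> \<delta>1 * (2 * lq_norm 1 \<theta>s)"
  proof (rule mult_left_mono)
    have "lq_norm 1 (\<theta>h - \<theta>s) \<le> lq_norm 1 \<theta>h + lq_norm 1 \<theta>s"
      unfolding lq_norm_1 sum.distrib[symmetric] by (rule sum_mono) simp
    then show "lq_norm 1 (\<theta>h - \<theta>s) \<le> 2 * lq_norm 1 \<theta>s" using l1 by simp
  qed (use pos in simp)
  finally have "\<bar>(transpose (M1 X \<Xi>) *v (\<theta>h - \<theta>s)) $ j\<bar> \<le> \<delta>1 * (2 * lq_norm 1 \<theta>s)" .
  moreover have "\<bar>?r $ j\<bar> \<le> \<mu> * lq_norm 1 \<theta>h + \<tau>"
    using feas by (simp add: feasible_def lq_norm_infty_le_iff)
  moreover have "\<bar>?w $ j\<bar> < \<mu> * lq_norm 1 \<theta>h + \<tau>" by (rule noise_less)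
  moreover have "?r $ j = ?w $ j - (gram X *v (\<theta>h - \<theta>s)) $ j - (transpose (M1 X \<Xi>) *v (\<theta>h - \<theta>s)) $ j"
    unfolding residual_decomposition[of _ _ _ _ _ _ \<sigma>2] by simp
  moreover have "\<mu> * lq_norm 1 \<theta>h \<le> \<mu> * lq_norm 1 \<theta>s" using l1 pos by simp
  moreover have "\<nu> = 2 * (\<mu> * lq_norm 1 \<theta>s) + \<delta>1 * (2 * lq_norm 1 \<theta>s) + 2 * \<tau>"
    by (simp add: \<nu> algebra_simps)
  ultimately show ?thesis by linarith
qed

lemma estimation_bounds:
  assumes s: "1 \<le> s" and \<Theta>: "\<theta>s \<in> \<Theta>" and sparse: "s_sparse s \<theta>s"
    and min: "is_arg_min (lq_norm 1) (\<lambda>\<theta>. \<theta> \<in> feasible \<Theta> (X + \<Xi>) (X *v \<theta>s + \<xi>) \<sigma>2h \<mu> \<tau>) \<theta>h"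
  shows RE_prediction: "\<And>\<kappa>. RE (gram X) s \<kappa> \<Longrightarrow> lq_norm 1 (\<theta>h - \<theta>s) \<le> 4 * \<nu> * real s / \<kappa> \<and>
      (1 / real CARD('n)) * (norm (X *v (\<theta>h - \<theta>s)))\<^sup>2 \<le> 4 * \<nu>\<^sup>2 * real s / \<kappa>"
    and RE_estimation: "\<And>\<kappa> q. RE (gram X) (2 * s) \<kappa> \<Longrightarrow> 1 < q \<Longrightarrow> q \<le> 2 \<Longrightarrow>
      lq_norm (ereal q) (\<theta>h - \<theta>s) \<le> 4 * \<nu> * real s powr (1 / q) / \<kappa>"
    and coherence_estimation: "\<And>\<rho> q. assumption_C (gram X) \<rho> \<Longrightarrow> \<rho> < 1 / (2 * real s) \<Longrightarrow> 1 \<le> q \<Longrightarrow>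
      lq_norm q (\<theta>h - \<theta>s) < (2 * real s) powr real_of_ereal (1 / q) * \<nu> / (1 - 2 * \<rho> * real s)"
proof -
  let ?\<Delta> = "\<theta>h - \<theta>s" and ?J = "{j. \<theta>s $ j \<noteq> 0}"
  have J: "card ?J \<le> s" using sparse by (simp add: s_sparse_def)
  have l1: "lq_norm 1 \<theta>h \<le> lq_norm 1 \<theta>s" using minimizer_lq_norm_1_le[OF \<Theta> min] .
  then have cone: "?\<Delta> \<in> cone_C ?J" by (rule diff_in_cone_C_support)
  have less: "\<bar>(gram X *v ?\<Delta>) $ j\<bar> < \<nu>" for j
    using min l1 by (intro gram_residual_less[where \<Theta> = \<Theta>]) (simp_all add: is_arg_min_def)
  then have le: "\<bar>(gram X *v ?\<Delta>) $ j\<bar> \<le> \<nu>" for j by (rule less_imp_le)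
  have \<nu>: "\<nu> > 0" using less[of undefined] by linarith
  show "lq_norm 1 ?\<Delta> \<le> 4 * \<nu> * real s / \<kappa> \<and>
      (1 / real CARD('n)) * (norm (X *v ?\<Delta>))\<^sup>2 \<le> 4 * \<nu>\<^sup>2 * real s / \<kappa>"
    if RE: "RE (gram X) s \<kappa>" for \<kappa>
  proof
    show b: "lq_norm 1 ?\<Delta> \<le> 4 * \<nu> * real s / \<kappa>"
      using RE_l1_bound[OF RE order_refl J cone le] \<nu> by simp
    \<comment> \<open>The prediction error is the quadratic form of the Gram matrix, so the duality
      of \<ell>_1 and \<ell>_\<infinity> reduces it to the bound just shown.\<close>
    have "(1 / real CARD('n)) * (norm (X *v ?\<Delta>))\<^sup>2 \<le> \<nu> * lq_norm 1 ?\<Delta>"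
      using abs_inner_le[OF le, of ?\<Delta>] by (simp add: inner_gram)
    also have "\<dots> \<le> \<nu> * (4 * \<nu> * real s / \<kappa>)" using b \<nu> by (intro mult_left_mono) auto
    finally show "(1 / real CARD('n)) * (norm (X *v ?\<Delta>))\<^sup>2 \<le> 4 * \<nu>\<^sup>2 * real s / \<kappa>"
      by (simp add: power2_eq_square mult_ac)
  qed
  show "lq_norm (ereal q) ?\<Delta> \<le> 4 * \<nu> * real s powr (1 / q) / \<kappa>"
    if RE: "RE (gram X) (2 * s) \<kappa>" and q: "1 < q" "q \<le> 2" for \<kappa> q
  proof -
    have \<kappa>: "\<kappa> > 0" using RE by (simp add: RE_def)
    have "(\<Sum>j\<in>UNIV. (?\<Delta> $ j)\<^sup>2) \<le> 8 * \<nu>\<^sup>2 * real s / \<kappa>\<^sup>2"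
      using s \<nu> by (intro RE_l2_bound[OF RE _ J cone le]) auto
    \<comment> \<open>Weakening 8 to 16 gives the \<ell>_1 and \<ell>_2 bounds the common scale t =
      4 \<nu> / \<kappa>, as the interpolation requires with r = s.\<close>
    also have "\<dots> \<le> 16 * \<nu>\<^sup>2 * real s / \<kappa>\<^sup>2"
      by (intro divide_right_mono mult_right_mono) auto
    also have "\<dots> = (4 * \<nu> / \<kappa>)\<^sup>2 * real s" by (simp add: power_divide power_mult_distrib)
    finally have "lq_norm (ereal q) ?\<Delta> \<le> 4 * \<nu> / \<kappa> * real s powr (1 / q)"
      using q s \<nu> \<kappa> RE_l1_bound[OF RE _ J cone le]
      by (intro lq_norm_le_interpolation) (auto simp: field_simps)
    then show ?thesis by simp
  qed
  show "lq_norm q ?\<Delta> < (2 * real s) powr real_of_ereal (1 / q) * \<nu> / (1 - 2 * \<rho> * real s)"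
    if C: "assumption_C (gram X) \<rho>" "\<rho> < 1 / (2 * real s)" and q: "1 \<le> q" for \<rho> q
  proof -
    have "s > 0" using s by simp
    note bounds = assumption_C_infty_bound[OF C this J cone less]
    have "lq_norm q ?\<Delta> \<le> (2 * real s) powr real_of_ereal (1 / q) * lq_norm \<infinity> ?\<Delta>"
      using q bounds(1) \<open>s > 0\<close> lq_norm_infty_le_iff[of ?\<Delta> "lq_norm \<infinity> ?\<Delta>"]
      by (intro lq_norm_le_infty) auto
    also have "\<dots> < (2 * real s) powr real_of_ereal (1 / q) * (\<nu> / (1 - 2 * \<rho> * real s))"
      using bounds(2) \<open>s > 0\<close> by (intro mult_strict_left_mono) auto
    finally show ?thesis by simp
  qed
qed

end

section \<open>Measurability and the union bound\<close>

lemma borel_measurable_vec_nth: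
  fixes f :: "'w \<Rightarrow> 'a::{second_countable_topology, real_normed_vector} ^ 'i"
  assumes "f \<in> borel_measurable M"
  shows "(\<lambda>\<omega>. f \<omega> $ i) \<in> borel_measurable M"
  using assms by (rule borel_measurable_continuous_on[rotated]) (intro continuous_intros)

text \<open>For the opposite inequality the maximum becomes a finite conjunction of measurable
  conditions on the coordinates.\<close>

lemma sets_lq_norm_infty_ge:
  assumes [measurable]: "\<And>j. (\<lambda>\<omega>. f \<omega> $ j) \<in> borel_measurable M"
  shows "{\<omega> \<in> space M. lq_norm \<infinity> (f \<omega>) \<ge> c} \<in> sets M"
  unfolding not_less[symmetric] lq_norm_infty_less_iff by measurable

lemma sets_max_entry_ge:
  assumes [measurable]: "\<And>i j. (\<lambda>\<omega>. A \<omega> $ i $ j) \<in> borel_measurable M"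
  shows "{\<omega> \<in> space M. max_entry (A \<omega>) \<ge> c} \<in> sets M"
  unfolding not_less[symmetric] max_entry_less_iff by measurable

text \<open>Union bound over the bad events. Nesting the unions to the right lets
  \<open>measure_Un_le\<close> be iterated in the second summand.\<close>

lemma (in prob_space) prob_Int6_ge:
  assumes "A1 \<in> events" "A2 \<in> events" "A3 \<in> events" "A4 \<in> events" "A5 \<in> events" "A6 \<in> events"
    and "prob A1 \<le> \<epsilon>" "prob A2 \<le> \<epsilon>" "prob A3 \<le> \<epsilon>" "prob A4 \<le> \<epsilon>" "prob A5 \<le> \<epsilon>" "prob A6 \<le> \<epsilon>"
  shows "prob (space M - (A1 \<union> (A2 \<union> (A3 \<union> (A4 \<union> (A5 \<union> A6)))))) \<ge> 1 - 6 * \<epsilon>"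
proof -
  have "prob (A1 \<union> (A2 \<union> (A3 \<union> (A4 \<union> (A5 \<union> A6))))) \<le> prob A1 + (prob A2 + (prob A3 + (prob A4 + (prob A5 + prob A6))))"
    using assms(1-6) by (intro order_trans[OF measure_Un_le] add_left_mono sets.Un) auto
  then show ?thesis using assms by (subst prob_compl) auto
qed

text \<open>The event is fixed before the minimizer and the constants, so all three parts hold on it
  simultaneously, for every minimizer and every \<open>q\<close>.\<close>

theorem theorem2:
  fixes M :: "'w measure"
    and X \<Xi> Z :: "'w \<Rightarrow> real ^ 'p ^ 'n"
    and \<xi> y :: "'w \<Rightarrow> real ^ 'n"
    and \<sigma>2h :: "'w \<Rightarrow> real ^ 'p"
    and \<sigma>2 \<theta>_star :: "real ^ 'p"
    and \<Theta> :: "(real ^ 'p) set"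
    and s :: nat
    and \<epsilon> b \<delta>1 \<delta>2 \<delta>3 \<delta>4 \<delta>5 \<mu> \<tau> \<nu> :: real
  assumes "prob_space M"
    and "X \<in> borel_measurable M" and "\<Xi> \<in> borel_measurable M"
    and "\<xi> \<in> borel_measurable M" and "\<sigma>2h \<in> borel_measurable M"
    and "\<And>i j. integrable M (\<lambda>\<omega>. (\<Xi> \<omega> $ i $ j)\<^sup>2)"
    and "\<sigma>2 = noise_var M \<Xi>"
    and "1 \<le> s" and "s \<le> CARD('p)"
    and "\<theta>_star \<in> \<Theta>" and "s_sparse s \<theta>_star"
    and "\<And>\<omega>. \<omega> \<in> space M \<Longrightarrow> y \<omega> = X \<omega> *v \<theta>_star + \<xi> \<omega>"
    and "\<And>\<omega>. \<omega> \<in> space M \<Longrightarrow> Z \<omega> = X \<omega> + \<Xi> \<omega>"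
    and "\<epsilon> \<ge> 0" and "b \<ge> 0"
    and "\<delta>1 \<ge> 0" and "\<delta>2 \<ge> 0" and "\<delta>3 \<ge> 0" and "\<delta>4 \<ge> 0" and "\<delta>5 \<ge> 0"
    and "measure M {\<omega> \<in> space M. (MAX j\<in>UNIV. \<bar>\<sigma>2h \<omega> $ j - \<sigma>2 $ j\<bar>) \<ge> b} \<le> \<epsilon>"
    and "measure M {\<omega> \<in> space M. max_entry (M1 (X \<omega>) (\<Xi> \<omega>)) \<ge> \<delta>1} \<le> \<epsilon>"
    and "measure M {\<omega> \<in> space M. lq_norm \<infinity> (M2 (X \<omega>) (\<xi> \<omega>)) \<ge> \<delta>2} \<le> \<epsilon>"
    and "measure M {\<omega> \<in> space M. lq_norm \<infinity> (M3 (\<Xi> \<omega>) (\<xi> \<omega>)) \<ge> \<delta>3} \<le> \<epsilon>"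
    and "measure M {\<omega> \<in> space M. max_entry (M4 (\<Xi> \<omega>)) \<ge> \<delta>4} \<le> \<epsilon>"
    and "measure M {\<omega> \<in> space M. max_entry (M5 \<sigma>2 (\<Xi> \<omega>)) \<ge> \<delta>5} \<le> \<epsilon>"
    and "\<mu> = \<delta>1 + \<delta>4 + \<delta>5 + b"
    and "\<tau> = \<delta>2 + \<delta>3"
    and "\<nu> = 2 * (\<mu> + \<delta>1) * lq_norm 1 \<theta>_star + 2 * \<tau>"
  shows "\<exists>E \<in> sets M. measure M E \<ge> 1 - 6 * \<epsilon> \<and>
    (\<forall>\<omega> \<in> E. \<forall>\<theta>h.
      is_arg_min (lq_norm 1) (\<lambda>\<theta>. \<theta> \<in> feasible \<Theta> (Z \<omega>) (y \<omega>) (\<sigma>2h \<omega>) \<mu> \<tau>) \<theta>h \<longrightarrow>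
        (\<forall>\<kappa>. RE (gram (X \<omega>)) s \<kappa> \<longrightarrow>
            lq_norm 1 (\<theta>h - \<theta>_star) \<le> 4 * \<nu> * real s / \<kappa> \<and>
            (1 / real CARD('n)) * (norm (X \<omega> *v (\<theta>h - \<theta>_star)))\<^sup>2 \<le> 4 * \<nu>\<^sup>2 * real s / \<kappa>) \<and>
        (\<forall>\<kappa>. 2 * s \<le> CARD('p) \<and> RE (gram (X \<omega>)) (2 * s) \<kappa> \<longrightarrow>
            (\<forall>q::real. 1 < q \<and> q \<le> 2 \<longrightarrow>
               lq_norm (ereal q) (\<theta>h - \<theta>_star) \<le> 4 * \<nu> * real s powr (1 / q) / \<kappa>)) \<and>
        (\<forall>\<rho>. assumption_C (gram (X \<omega>)) \<rho> \<and> \<rho> < 1 / (2 * real s) \<longrightarrow>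
            (\<forall>q::ereal. 1 \<le> q \<longrightarrow>
               lq_norm q (\<theta>h - \<theta>_star)
                 < (2 * real s) powr real_of_ereal (1 / q) * \<nu> / (1 - 2 * \<rho> * real s))))"
proof -
  interpret prob_space M by fact
  \<comment> \<open>One projection gives the coordinates of vectors and the rows of matrices, a
    second one the matrix entries.\<close>
  note [measurable] = assms(2-5)[THEN borel_measurable_vec_nth]
    assms(2,3)[THEN borel_measurable_vec_nth, THEN borel_measurable_vec_nth]
  let ?A0 = "{\<omega> \<in> space M. (MAX j\<in>UNIV. \<bar>\<sigma>2h \<omega> $ j - \<sigma>2 $ j\<bar>) \<ge> b}"
  let ?A1 = "{\<omega> \<in> space M. max_entry (M1 (X \<omega>) (\<Xi> \<omega>)) \<ge> \<delta>1}"
  let ?A2 = "{\<omega> \<in> space M. lq_norm \<infinity> (M2 (X \<omega>) (\<xi> \<omega>)) \<ge> \<delta>2}"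
  let ?A3 = "{\<omega> \<in> space M. lq_norm \<infinity> (M3 (\<Xi> \<omega>) (\<xi> \<omega>)) \<ge> \<delta>3}"
  let ?A4 = "{\<omega> \<in> space M. max_entry (M4 (\<Xi> \<omega>)) \<ge> \<delta>4}"
  let ?A5 = "{\<omega> \<in> space M. max_entry (M5 \<sigma>2 (\<Xi> \<omega>)) \<ge> \<delta>5}"
  let ?E = "space M - (?A0 \<union> (?A1 \<union> (?A2 \<union> (?A3 \<union> (?A4 \<union> ?A5)))))"
  \<comment> \<open>The explicit maximum is the \<ell>_\<infinity> norm of the difference, so the
    general measurability lemma applies.\<close>
  have "?A0 = {\<omega> \<in> space M. lq_norm \<infinity> (\<sigma>2h \<omega> - \<sigma>2) \<ge> b}"
    by (simp add: lq_norm_def)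
  also have "\<dots> \<in> events"
    by (rule sets_lq_norm_infty_ge) simp
  finally have "?A0 \<in> events" .
  moreover have "?A1 \<in> events"
    by (rule sets_max_entry_ge) (simp add: M1_def transpose_def matrix_matrix_mult_def)
  moreover have "?A2 \<in> events"
    by (rule sets_lq_norm_infty_ge)
      (simp add: M2_def transpose_def matrix_vector_mult_def del: transpose_matrix_vector)
  moreover have "?A3 \<in> events"
    by (rule sets_lq_norm_infty_ge)
      (simp add: M3_def transpose_def matrix_vector_mult_def del: transpose_matrix_vector)
  moreover have "?A4 \<in> events"
    by (rule sets_max_entry_ge)
      (simp add: M4_def Diag_def diag_mat_def transpose_def matrix_matrix_mult_def cong: if_cong)
  moreover have "?A5 \<in> events"
    by (rule sets_max_entry_ge)
      (simp add: M5_def Diag_def diag_mat_def transpose_def matrix_matrix_mult_def cong: if_cong)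
  ultimately have ev: "?A0 \<in> events" "?A1 \<in> events" "?A2 \<in> events" "?A3 \<in> events" "?A4 \<in> events" "?A5 \<in> events"
    by this+
  have "prob ?E \<ge> 1 - 6 * \<epsilon>" by (rule prob_Int6_ge[OF ev]) fact+
  moreover have "?E \<in> events" using ev by (intro sets.compl_sets sets.Un)
  moreover have small: "small_errors (X \<omega>) (\<Xi> \<omega>) (\<xi> \<omega>) (\<sigma>2h \<omega>) \<sigma>2 \<theta>_star b \<delta>1 \<delta>2 \<delta>3 \<delta>4 \<delta>5 \<mu> \<tau> \<nu>"
    if "\<omega> \<in> ?E" for \<omega>
    using that assms(27-29) by unfold_locales (auto simp: not_le)
  ultimately show ?thesis
  proof (intro bexI[of _ ?E] conjI ballI allI impI)
    fix \<omega> \<theta>h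
    assume E: "\<omega> \<in> ?E"
      and *: "is_arg_min (lq_norm 1) (\<lambda>\<theta>. \<theta> \<in> feasible \<Theta> (Z \<omega>) (y \<omega>) (\<sigma>2h \<omega>) \<mu> \<tau>) \<theta>h"
    \<comment> \<open>The model equations for \<open>y\<close> and \<open>Z\<close> are available
      only on \<open>space M\<close>.\<close>
    have "\<omega> \<in> space M" using E by blast
    with * have min: "is_arg_min (lq_norm 1)
        (\<lambda>\<theta>. \<theta> \<in> feasible \<Theta> (X \<omega> + \<Xi> \<omega>) (X \<omega> *v \<theta>_star + \<xi> \<omega>) (\<sigma>2h \<omega>) \<mu> \<tau>) \<theta>h"
      using assms(12,13) by simp
    note bounds = small_errors.estimation_bounds[OF small[OF E] assms(8,10,11) min]
    show "lq_norm 1 (\<theta>h - \<theta>_star) \<le> 4 * \<nu> * real s / \<kappa>"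
      and "(1 / real CARD('n)) * (norm (X \<omega> *v (\<theta>h - \<theta>_star)))\<^sup>2 \<le> 4 * \<nu>\<^sup>2 * real s / \<kappa>"
      if "RE (gram (X \<omega>)) s \<kappa>" for \<kappa>
      using bounds(1)[OF that] by blast+
    show "lq_norm (ereal q) (\<theta>h - \<theta>_star) \<le> 4 * \<nu> * real s powr (1 / q) / \<kappa>"
      if "2 * s \<le> CARD('p) \<and> RE (gram (X \<omega>)) (2 * s) \<kappa>" "1 < q \<and> q \<le> 2" for \<kappa> q
      using that by (intro bounds(2)) simp_all
    show "lq_norm q (\<theta>h - \<theta>_star)
        < (2 * real s) powr real_of_ereal (1 / q) * \<nu> / (1 - 2 * \<rho> * real s)"
      if "assumption_C (gram (X \<omega>)) \<rho> \<and> \<rho> < 1 / (2 * real s)" "1 \<le> q" for \<rho> q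
      using that by (intro bounds(3)) simp_all
  qed
qed

end
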